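(* Let $P$ be a finite poset. Then the following implications hold for $P$: (a) If $P$ is (VT) and connected, then $P$ has (UM) and (CLMEE). (b) (VT) implies that $P$ is ranked and has (CLE). (c) (VT) and (NTC) imply (SS). (d) (D$3^-$CF) implies (NTC). (e) (D$3^-$C) and (D3MF) imply (VT) and (FT). (f) (D$3^-$C) and (D3MD) imply (NCC), (NTC), and (UC3).
   Context: Write $x\rightarrow y$ when $y$ covers $x$; $\{x,y\}\rightarrow z$ means $x\to z$ and $y\to z$; $w\to\{x,y\}$ means $w\to x$ and $w\to y$. Letters $u,w,w',x,y,z$ in sets below denote distinct elements. $P$ is connected if its Hasse diagram is connected (and nonempty). A chain is a sequence $x_1\to x_2\to\cdots\to x_n$, $n\ge1$, of length $n-1$. A rank function is $\rho:P\to\mathbb Z$ such that $x\to y$ implies $\rho(y)=\rho(x)+1$; $P$ is ranked if it has one. A diamond is a set $\{w;x,y;z\}$ with $w\to\{x,y\}$ and $\{x,y\}\to z$; its top is $z$, its elbows are $x,y$. An interval $[w,z]$ is a $d_3$-interval if it is a diamond $\{w;x,y;z\}$ for some $x,y$. A vee, or $d_3^-$-set, is a set $\{w;x,y\}$ with $w\to\{x,y\}$; a completing element of it is a $z$ such that $\{w;x,y;z\}$ is a $d_3$-interval. Two $d_3^-$-sets $\{w;x,y\}$ and $\{w';x,y\}$ with $w\ne w'$ overlap. Two $d_3$-intervals are distinct if they differ as sets. An interval $[w,z]$ is short if there is $u$ with $w\to u\to z$. Axioms: (VT) $w\to\{x,y\}$ implies there is $z$ with $\{x,y\}\to z$. (D$3^-$C)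 for each $d_3^-$-set $S$ there is $z$ such that $S\cup\{z\}$ is a $d_3$-interval. (FT) the top of each diamond covers only the elbows of the diamond. (D3MF) the maximum element of each $d_3$-interval covers only the elbows of the interval. (D$3^-$CF) for each $d_3^-$-set $S$ there is $z$ such that $S\cup\{z\}$ is a $d_3$-interval with maximum $z$ and $z$ covers only elements of $S$. (NCC) there do not exist overlapping $d_3^-$-sets. (D3MD) the maximum elements of distinct $d_3$-intervals are distinct. Properties: (UM) there is a unique maximal element. (CLMEE) (UM) holds and for each element $w$ every chain from $w$ to the unique maximal element has the same length. (CLE) whenever $x<y$, all chains from $x$ to $y$ have equal length. (SS) whenever $[w,z]$ is a short interval, $|[w,z]|\in\{3,4\}$. (NTC) no element is covered by three (distinct) elements. (UC3) each $d_3^-$-set has exactly one completing element. *)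

theory Defs
  imports Main
begin

text \<open>
  A poset is a carrier \<open>P\<close> with a reflexive order relation \<open>r\<close> such that
  \<open>partial_order_on P r\<close>; this includes \<open>r \<subseteq> P \<times> P\<close>, so a definition that only
  mentions \<open>r\<close> speaks about elements of \<open>P\<close>. The empty poset is allowed.
\<close>

definition covers :: "'a rel \<Rightarrow> 'a \<Rightarrow> 'a \<Rightarrow> bool" where
  \<comment> \<open>\<open>covers r x y\<close> is \<open>x \<rightarrow> y\<close>: the \<^emph>\<open>second\<close> element covers the first.\<close>
  "covers r x y \<longleftrightarrow> (x, y) \<in> r \<and> x \<noteq> y \<and>
     (\<forall>v. (x, v) \<in> r \<longrightarrow> (v, y) \<in> r \<longrightarrow> v = x \<or> v = y)"

definition interval :: "'a rel \<Rightarrow> 'a \<Rightarrow> 'a \<Rightarrow> 'a set" where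
  "interval r w z = {v. (w, v) \<in> r \<and> (v, z) \<in> r}"

definition hasse_connected :: "'a set \<Rightarrow> 'a rel \<Rightarrow> bool" where
  "hasse_connected P r \<longleftrightarrow> P \<noteq> {} \<and>
     (\<forall>x\<in>P. \<forall>y\<in>P. (\<lambda>u v. covers r u v \<or> covers r v u)\<^sup>*\<^sup>* x y)"

definition chain :: "'a set \<Rightarrow> 'a rel \<Rightarrow> 'a list \<Rightarrow> bool" where
  "chain P r xs \<longleftrightarrow> xs \<noteq> [] \<and> set xs \<subseteq> P \<and> successively (covers r) xs"

definition chain_from_to :: "'a set \<Rightarrow> 'a rel \<Rightarrow> 'a \<Rightarrow> 'a \<Rightarrow> 'a list \<Rightarrow> bool" where
  "chain_from_to P r x y xs \<longleftrightarrow> chain P r xs \<and> hd xs = x \<and> last xs = y"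

definition chain_length :: "'a list \<Rightarrow> nat" where
  "chain_length xs = length xs - 1"

definition rank_function :: "'a rel \<Rightarrow> ('a \<Rightarrow> int) \<Rightarrow> bool" where
  "rank_function r \<rho> \<longleftrightarrow> (\<forall>x y. covers r x y \<longrightarrow> \<rho> y = \<rho> x + 1)"

definition ranked :: "'a rel \<Rightarrow> bool" where
  "ranked r \<longleftrightarrow> (\<exists>\<rho>. rank_function r \<rho>)"

text \<open>
  The arguments of \<open>vee\<close>, \<open>diamond\<close> and \<open>d3\<close> are the members of \<open>{w;x,y}\<close> and
  \<open>{w;x,y;z}\<close> in their respective roles (bottom, two elbows, top). The only distinctness
  that does not follow from the covering relations is that of the two elbows.
\<close>

definition vee :: "'a rel \<Rightarrow> 'a \<Rightarrow> 'a \<Rightarrow> 'a \<Rightarrow> bool" where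
  "vee r w x y \<longleftrightarrow> x \<noteq> y \<and> covers r w x \<and> covers r w y"

definition diamond :: "'a rel \<Rightarrow> 'a \<Rightarrow> 'a \<Rightarrow> 'a \<Rightarrow> 'a \<Rightarrow> bool" where
  "diamond r w x y z \<longleftrightarrow> x \<noteq> y \<and> covers r w x \<and> covers r w y \<and> covers r x z \<and> covers r y z"

definition d3 :: "'a rel \<Rightarrow> 'a \<Rightarrow> 'a \<Rightarrow> 'a \<Rightarrow> 'a \<Rightarrow> bool" where
  \<comment> \<open>the labelled set \<open>{w;x,y;z}\<close> is a $d_3$-interval\<close>
  "d3 r w x y z \<longleftrightarrow> diamond r w x y z \<and> interval r w z = {w, x, y, z}"

definition d3_interval :: "'a rel \<Rightarrow> 'a set \<Rightarrow> bool" where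
  \<comment> \<open>the same for a bare set, without prescribed roles\<close>
  "d3_interval r I \<longleftrightarrow> (\<exists>w x y z. I = {w, x, y, z} \<and> d3 r w x y z)"

definition d3_minus_set :: "'a rel \<Rightarrow> 'a set \<Rightarrow> bool" where
  "d3_minus_set r S \<longleftrightarrow> (\<exists>w x y. S = {w, x, y} \<and> vee r w x y)"

definition maximum_of :: "'a rel \<Rightarrow> 'a set \<Rightarrow> 'a \<Rightarrow> bool" where
  "maximum_of r I z \<longleftrightarrow> z \<in> I \<and> (\<forall>v\<in>I. (v, z) \<in> r)"

definition completing :: "'a rel \<Rightarrow> 'a \<Rightarrow> 'a \<Rightarrow> 'a \<Rightarrow> 'a \<Rightarrow> bool" where
  "completing r w x y z \<longleftrightarrow> vee r w x y \<and> d3 r w x y z"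

definition covers_only :: "'a rel \<Rightarrow> 'a \<Rightarrow> 'a set \<Rightarrow> bool" where
  \<comment> \<open>every element covered by \<open>z\<close> lies in \<open>S\<close>\<close>
  "covers_only r z S \<longleftrightarrow> (\<forall>v. covers r v z \<longrightarrow> v \<in> S)"

definition VT :: "'a rel \<Rightarrow> bool" where
  "VT r \<longleftrightarrow> (\<forall>w x y. vee r w x y \<longrightarrow> (\<exists>z. covers r x z \<and> covers r y z))"

definition D3mC :: "'a rel \<Rightarrow> bool" where
  "D3mC r \<longleftrightarrow> (\<forall>S. d3_minus_set r S \<longrightarrow> (\<exists>z. d3_interval r (S \<union> {z})))"

definition FT :: "'a rel \<Rightarrow> bool" where
  "FT r \<longleftrightarrow> (\<forall>w x y z. diamond r w x y z \<longrightarrow> covers_only r z {x, y})"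

definition D3MF :: "'a rel \<Rightarrow> bool" where
  "D3MF r \<longleftrightarrow> (\<forall>w x y z. d3 r w x y z \<longrightarrow> covers_only r z {x, y})"

definition D3mCF :: "'a rel \<Rightarrow> bool" where
  "D3mCF r \<longleftrightarrow> (\<forall>S. d3_minus_set r S \<longrightarrow>
     (\<exists>z. d3_interval r (S \<union> {z}) \<and> maximum_of r (S \<union> {z}) z \<and> covers_only r z S))"

definition NCC :: "'a rel \<Rightarrow> bool" where
  "NCC r \<longleftrightarrow> \<not> (\<exists>w w' x y. vee r w x y \<and> vee r w' x y \<and> w \<noteq> w')"

definition D3MD :: "'a rel \<Rightarrow> bool" where
  "D3MD r \<longleftrightarrow> (\<forall>I J m n. d3_interval r I \<longrightarrow> d3_interval r J \<longrightarrow> I \<noteq> J \<longrightarrow>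
     maximum_of r I m \<longrightarrow> maximum_of r J n \<longrightarrow> m \<noteq> n)"

definition maximal_in :: "'a set \<Rightarrow> 'a rel \<Rightarrow> 'a \<Rightarrow> bool" where
  "maximal_in P r m \<longleftrightarrow> m \<in> P \<and> (\<forall>v\<in>P. (m, v) \<in> r \<longrightarrow> v = m)"

definition UM :: "'a set \<Rightarrow> 'a rel \<Rightarrow> bool" where
  "UM P r \<longleftrightarrow> (\<exists>!m. maximal_in P r m)"

definition CLMEE :: "'a set \<Rightarrow> 'a rel \<Rightarrow> bool" where
  "CLMEE P r \<longleftrightarrow> UM P r \<and>
     (\<forall>w\<in>P. \<forall>xs ys. chain_from_to P r w (THE m. maximal_in P r m) xs \<longrightarrow>
        chain_from_to P r w (THE m. maximal_in P r m) ys \<longrightarrow> chain_length xs = chain_length ys)"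

definition CLE :: "'a set \<Rightarrow> 'a rel \<Rightarrow> bool" where
  "CLE P r \<longleftrightarrow> (\<forall>x y. (x, y) \<in> r \<longrightarrow> x \<noteq> y \<longrightarrow>
     (\<forall>xs ys. chain_from_to P r x y xs \<longrightarrow> chain_from_to P r x y ys \<longrightarrow>
        chain_length xs = chain_length ys))"

definition SS :: "'a rel \<Rightarrow> bool" where
  "SS r \<longleftrightarrow> (\<forall>w z. (\<exists>u. covers r w u \<and> covers r u z) \<longrightarrow> card (interval r w z) \<in> {3, 4})"

definition NTC :: "'a rel \<Rightarrow> bool" where
  "NTC r \<longleftrightarrow> \<not> (\<exists>w x y z. x \<noteq> y \<and> x \<noteq> z \<and> y \<noteq> z \<and>
     covers r w x \<and> covers r w y \<and> covers r w z)"

definition UC3 :: "'a rel \<Rightarrow> bool" where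
  "UC3 r \<longleftrightarrow> (\<forall>w x y. vee r w x y \<longrightarrow> (\<exists>!z. completing r w x y z))"

end

theory Submission
  imports Defs
begin

text \<open>
  Under (VT), a Newman-style induction shows that all saturated chains from \<open>w\<close> to maximal elements
  have a common end and a common length; the negative of that length is a rank function, and
  connectedness makes the common end independent of \<open>w\<close>. This gives (a) and (b), and (c) follows since
  in a ranked poset a short interval consists of its end points and the atoms between them.
  For (d) and the (NTC) and (NCC) parts of (f), the forbidden configuration, suitably generalised,
  reproduces itself strictly further up, which is impossible in a finite poset. For (e), (d) applies
  and shows via (c) that every diamond is an interval.
\<close>

locale finite_poset =
  fixes P :: "'a set" and r :: "'a rel"
  assumes finite_P: "finite P" and po: "partial_order_on P r"
begin

section \<open>Order facts and induction along covers\<close>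

lemma rel_in: "(x, y) \<in> r \<Longrightarrow> x \<in> P \<and> y \<in> P"
  using po unfolding partial_order_on_def preorder_on_def by blast

lemma rel_refl: "x \<in> P \<Longrightarrow> (x, x) \<in> r"
  using po unfolding partial_order_on_def preorder_on_def refl_on_def by blast

lemma rel_trans: "(x, y) \<in> r \<Longrightarrow> (y, z) \<in> r \<Longrightarrow> (x, z) \<in> r"
  using po unfolding partial_order_on_def preorder_on_def trans_def by blast

lemma rel_antisym: "(x, y) \<in> r \<Longrightarrow> (y, x) \<in> r \<Longrightarrow> x = y"
  using po unfolding partial_order_on_def antisym_def by blast

lemma covers_rel: "covers r x y \<Longrightarrow> (x, y) \<in> r \<and> x \<noteq> y"
  unfolding covers_def by blast

lemma upper_covers_incomparable:
  "covers r w x \<Longrightarrow> covers r w y \<Longrightarrow> x \<noteq> y \<Longrightarrow> (x, y) \<notin> r"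
  unfolding covers_def by blast

lemma finite_strict: "finite (r - Id)"
proof -
  have "r - Id \<subseteq> P \<times> P" using rel_in by auto
  then show ?thesis using finite_P finite_subset by blast
qed

lemma acyclic_strict: "acyclic (r - Id)"
proof -
  have "trans (r - Id)"
    by (rule transI) (use rel_trans rel_antisym in blast)
  then show ?thesis
    by (simp add: acyclic_irrefl irrefl_def)
qed

text \<open>In a finite poset the converse of the strict order is well-founded, and every cover lies
  strictly above. Maximal elements have no covers, so they need no separate base case.\<close>

lemma up_induct [case_names up]:
  assumes "\<And>x. (\<And>y. covers r x y \<Longrightarrow> Q y) \<Longrightarrow> Q x"
  shows "Q x"
proof -
  have "wf ((r - Id)\<inverse>)"
    using finite_acyclic_wf_converse[OF finite_strict acyclic_strict] .
  then show ?thesis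
  proof (induction x rule: wf_induct_rule)
    case (less x)
    show ?case
      by (rule assms, rule less) (use covers_rel in auto)
  qed
qed

lemma cover_below:
  assumes "(x, y) \<in> r" "x \<noteq> y"
  obtains u where "covers r x u" "(u, y) \<in> r"
proof -
  have wf: "wf (r - Id)"
    \<comment> \<open>The cover will be a minimal element of the half-open interval of elements
      above \<open>x\<close> and up to \<open>y\<close>.\<close>
    using finite_acyclic_wf[OF finite_strict acyclic_strict] .
  let ?A = "{u. (x, u) \<in> r \<and> x \<noteq> u \<and> (u, y) \<in> r}"
  have "y \<in> ?A" using assms rel_in rel_refl by blast
  then obtain u where u: "u \<in> ?A" and min: "\<And>v. (v, u) \<in> r - Id \<Longrightarrow> v \<notin> ?A"
    by (rule wfE_min[OF wf]) blast
  have "covers r x u"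
    unfolding covers_def using u min rel_trans by blast
  then show thesis using that u by blast
qed

section \<open>Chains to maximal elements, and ranks under (VT)\<close>

lemma maximal_no_cover: "maximal_in P r m \<Longrightarrow> \<not> covers r m y"
  unfolding maximal_in_def using covers_rel rel_in by blast

lemma reaches_maximal:
  "x \<in> P \<Longrightarrow> \<exists>m n. maximal_in P r m \<and> (covers r ^^ n) x m"
proof (induction x rule: up_induct)
  case (up x)
  show ?case
  proof (cases "maximal_in P r x")
    case True
    then have "maximal_in P r x \<and> (covers r ^^ 0) x x" by simp
    then show ?thesis by blast
  next
    case False
    then obtain v where "(x, v) \<in> r" "x \<noteq> v"
      using up.prems unfolding maximal_in_def by blast
    then obtain u where u: "covers r x u" using cover_below by blast
    then obtain m n where "maximal_in P r m" "(covers r ^^ n) u m"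
      using up.IH[OF u] covers_rel rel_in by blast
    then show ?thesis using u relpowp_Suc_I2 by metis
  qed
qed

lemma VT_unique_end:
  assumes "VT r"
  shows "(covers r ^^ n) w m \<Longrightarrow> maximal_in P r m \<Longrightarrow>
    (covers r ^^ k) w m' \<Longrightarrow> maximal_in P r m' \<Longrightarrow> m = m' \<and> n = k"
proof (induction n arbitrary: w m k m')
  case 0
  then have "w = m" by simp
  then show ?case
  proof (cases k)
    case 0
    then show ?thesis using \<open>w = m\<close> "0.prems" by simp
  next
    case (Suc j)
    then obtain y where "covers r w y" using "0.prems" relpowp_Suc_D2 by metis
    then show ?thesis using \<open>w = m\<close> "0.prems" maximal_no_cover by blast
  qed
next
  case (Suc n)
  obtain x where x: "covers r w x" "(covers r ^^ n) x m"
    using Suc.prems(1) relpowp_Suc_D2 by metis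
  show ?case
  proof (cases k)
    case 0
    then show ?thesis using Suc.prems x maximal_no_cover by auto
  next
    case k: (Suc j)
    obtain y where y: "covers r w y" "(covers r ^^ j) y m'"
      using Suc.prems(3) k relpowp_Suc_D2 by metis
    show ?thesis
    proof (cases "x = y")
      case True
      then show ?thesis using Suc.IH[of x m j m'] Suc.prems x y k by simp
    next
      case False
      then obtain z where z: "covers r x z" "covers r y z"
        using assms x y unfolding VT_def vee_def by blast
      then obtain m'' l where l: "maximal_in P r m''" "(covers r ^^ l) z m''"
        using reaches_maximal covers_rel rel_in by blast
      \<comment> \<open>The induction hypothesis needs a chain of length \<open>n\<close>, so it is
        first available only at \<open>x\<close>. Comparison there with the route through
        \<open>z\<close> gives \<open>n = Suc l\<close>; the route from \<open>y\<close> through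
        \<open>z\<close> then also has length \<open>n\<close> and ends in \<open>m\<close>, which
        opens the hypothesis at \<open>y\<close>.\<close>
      have 1: "m = m'' \<and> n = Suc l"
        by (rule Suc.IH[OF x(2) Suc.prems(2) relpowp_Suc_I2[OF z(1) l(2)] l(1)])
      then have "(covers r ^^ n) y m" using relpowp_Suc_I2[OF z(2) l(2)] by simp
      from Suc.IH[OF this Suc.prems(2) y(2) Suc.prems(4)] show ?thesis
        using k by simp
    qed
  qed
qed

lemma VT_ranked:
  assumes "VT r"
  shows "ranked r"
proof -
  \<comment> \<open>On \<open>P\<close> the choice is forced, by existence and uniqueness of the
    length. Outside \<open>P\<close> the value is arbitrary, but covering relates only elements of
    \<open>P\<close>.\<close>
  let ?d = "\<lambda>x. SOME n. \<exists>m. maximal_in P r m \<and> (covers r ^^ n) x m"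
  have d: "?d x = n" if "maximal_in P r m" "(covers r ^^ n) x m" for x m n
    using that by (intro some_equality) (use VT_unique_end[OF assms] in blast)+
  have "- int (?d y) = - int (?d x) + 1" if xy: "covers r x y" for x y
  proof -
    obtain m n where mn: "maximal_in P r m" "(covers r ^^ n) y m"
      using reaches_maximal xy covers_rel rel_in by blast
    have "?d y = n" "?d x = Suc n"
      using d[OF mn] d[OF mn(1) relpowp_Suc_I2[OF xy mn(2)]] by blast+
    then show ?thesis by simp
  qed
  then show ?thesis unfolding ranked_def rank_function_def
    by (intro exI[of _ "\<lambda>x. - int (?d x)"]) blast
qed

lemma rank_chain:
  assumes "rank_function r \<rho>"
  shows "xs \<noteq> [] \<Longrightarrow> successively (covers r) xs \<Longrightarrow>
    \<rho> (last xs) = \<rho> (hd xs) + int (chain_length xs)"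
proof (induction xs rule: induct_list012)
  case (3 x y zs)
  then have "\<rho> y = \<rho> x + 1" using assms unfolding rank_function_def by simp
  with 3 show ?case by (simp add: chain_length_def)
qed (simp_all add: chain_length_def)

text \<open>Both lengths are the rank difference of the end points. This serves (CLE) and, with the
  maximal element as \<open>y\<close>, also (CLMEE).\<close>

lemma ranked_chain_length:
  assumes "ranked r" "chain_from_to P r x y xs" "chain_from_to P r x y ys"
  shows "chain_length xs = chain_length ys"
proof -
  obtain \<rho> where \<rho>: "rank_function r \<rho>" using assms(1) unfolding ranked_def by blast
  show ?thesis
    using rank_chain[OF \<rho>, of xs] rank_chain[OF \<rho>, of ys] assms(2,3)
    unfolding chain_from_to_def chain_def by simp
qed

lemma ranked_CLE: "ranked r \<Longrightarrow> CLE P r"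
  unfolding CLE_def using ranked_chain_length by blast

lemma VT_connected_UM:
  assumes VT: "VT r" and conn: "hasse_connected P r"
  shows "UM P r"
proof -
  \<comment> \<open>The set of maximal ends reachable from \<open>x\<close> is invariant along Hasse
    edges in both directions, hence constant on a connected poset.\<close>
  let ?top = "\<lambda>x m. maximal_in P r m \<and> (\<exists>n. (covers r ^^ n) x m)"
  have edge: "?top u m \<longleftrightarrow> ?top v m" if uv: "covers r u v" for u v m
  proof
    assume u: "?top u m"
    obtain m' n where m': "maximal_in P r m'" "(covers r ^^ n) v m'"
      using reaches_maximal uv covers_rel rel_in by blast
    with u have "m = m'"
      using VT_unique_end[OF VT] relpowp_Suc_I2[OF uv m'(2)] by blast
    then show "?top v m" using m' by blast
  next
    assume "?top v m"
    then show "?top u m" using uv relpowp_Suc_I2 by metis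
  qed
  have path: "?top x m \<longleftrightarrow> ?top y m"
    if "(\<lambda>u v. covers r u v \<or> covers r v u)\<^sup>*\<^sup>* x y" for x y m
    using that
  proof (induction rule: rtranclp_induct)
    case (step y z)
    then show ?case using edge by blast
  qed simp
  obtain x where x: "x \<in> P" using conn unfolding hasse_connected_def by blast
  then obtain m n where m: "maximal_in P r m" "(covers r ^^ n) x m"
    using reaches_maximal by blast
  have "m' = m" if m': "maximal_in P r m'" for m'
  proof -
    \<comment> \<open>The chain of length 0 makes a maximal element its own end; invariance carries
      this end to \<open>x\<close>.\<close>
    have "?top m' m'" using m' relpowp_0_I by metis
    moreover have "(\<lambda>u v. covers r u v \<or> covers r v u)\<^sup>*\<^sup>* m' x"
      using conn x m' unfolding hasse_connected_def maximal_in_def by blast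
    ultimately have "?top x m'" using path by blast
    then show ?thesis using VT_unique_end[OF VT] m by blast
  qed
  then show ?thesis unfolding UM_def using m by blast
qed

section \<open>Short intervals in ranked posets\<close>

lemma rank_strict_mono:
  assumes "rank_function r \<rho>"
  shows "(x, y) \<in> r \<Longrightarrow> x \<noteq> y \<Longrightarrow> \<rho> x < \<rho> y"
proof (induction x rule: up_induct)
  case (up x)
  obtain u where u: "covers r x u" "(u, y) \<in> r" using cover_below up.prems by blast
  then have "\<rho> u = \<rho> x + 1" using assms unfolding rank_function_def by blast
  moreover have "\<rho> u \<le> \<rho> y" using up.IH[OF u(1,2)] by (cases "u = y") auto
  ultimately show ?case by simp
qed

lemma ranked_short_interval:
  assumes "ranked r" "covers r w u" "covers r u z"
  shows "interval r w z = {w, z} \<union> {v. covers r w v \<and> covers r v z}"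
proof (intro equalityI subsetI)
  obtain \<rho> where \<rho>: "rank_function r \<rho>" using assms(1) unfolding ranked_def by blast
  have cov: "\<rho> b = \<rho> a + 1" if "covers r a b" for a b
    using \<rho> that unfolding rank_function_def by blast
  fix v assume "v \<in> interval r w z"
  then have v: "(w, v) \<in> r" "(v, z) \<in> r" unfolding interval_def by auto
  show "v \<in> {w, z} \<union> {v. covers r w v \<and> covers r v z}"
  proof (cases "v = w \<or> v = z")
    case False
    \<comment> \<open>The ranks of \<open>w\<close> and \<open>z\<close> differ by 2. A strict step
      from \<open>a\<close> to \<open>v\<close> or from \<open>b\<close> to \<open>z\<close> would
      exceed that gap, so \<open>a = v\<close> and \<open>b = z\<close>.\<close>
    obtain a where a: "covers r w a" "(a, v) \<in> r" using cover_below v False by metis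
    obtain b where b: "covers r v b" "(b, z) \<in> r" using cover_below v False by metis
    have z: "\<rho> z = \<rho> w + 2" using cov[OF assms(2)] cov[OF assms(3)] by simp
    have "\<rho> v < \<rho> z" using rank_strict_mono[OF \<rho> v(2)] False by simp
    then have "a = v" using rank_strict_mono[OF \<rho> a(2)] cov[OF a(1)] z by force
    moreover from this have "b = z"
      using rank_strict_mono[OF \<rho> b(2)] cov[OF a(1)] cov[OF b(1)] z by force
    ultimately show ?thesis using a b by simp
  qed blast
next
  fix v assume "v \<in> {w, z} \<union> {v. covers r w v \<and> covers r v z}"
  then show "v \<in> interval r w z"
    using assms(2,3) covers_rel rel_trans rel_in rel_refl unfolding interval_def by blast
qed

lemma VT_NTC_SS:
  assumes VT: "VT r" and NTC: "NTC r"
  shows "SS r"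
  unfolding SS_def
proof (intro allI impI, elim exE conjE)
  fix w z u assume u: "covers r w u" "covers r u z"
  let ?A = "{v. covers r w v \<and> covers r v z}"
  have int: "interval r w z = {w, z} \<union> ?A"
    using ranked_short_interval[OF VT_ranked[OF VT] u] .
  have "w \<noteq> z" using u covers_rel rel_antisym by blast
  moreover have "w \<notin> ?A" "z \<notin> ?A" using covers_rel by blast+
  \<comment> \<open>Here \<open>v = u\<close> is allowed: it gives cardinality 3, and
    \<open>v\<close> different from \<open>u\<close> gives 4.\<close>
  moreover have "\<exists>v. ?A = {u, v}"
  proof (cases "?A \<subseteq> {u}")
    case True
    then have "?A = {u, u}" using u by blast
    then show ?thesis by blast
  next
    case False
    then obtain v where v: "v \<in> ?A" "v \<noteq> u" by blast
    then have "?A = {u, v}" using NTC u unfolding NTC_def by blast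
    then show ?thesis by blast
  qed
  then obtain v where v: "?A = {u, v}" by blast
  ultimately show "card (interval r w z) \<in> {3, 4}"
    unfolding int v by (cases "u = v") auto
qed

section \<open>Recovering roles from unlabelled sets\<close>

text \<open>The order fixes the roles: the bottom and top are the least and greatest elements of the
  set, and the elbows are what remains, up to a swap.\<close>

lemma d3_of_union:
  assumes vee: "vee r w x y" and I: "d3_interval r ({w, x, y} \<union> {z})"
  shows "d3 r w x y z"
proof -
  obtain w' x' y' z' where S: "{w, x, y} \<union> {z} = {w', x', y', z'}" and d: "d3 r w' x' y' z'"
    using I unfolding d3_interval_def by blast
  have D: "x' \<noteq> y'" "covers r w' x'" "covers r w' y'" "covers r x' z'" "covers r y' z'"
    and int: "interval r w' z' = {w', x', y', z'}"
    using d unfolding d3_def diamond_def by auto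
  have V: "x \<noteq> y" "covers r w x" "covers r w y" using vee unfolding vee_def by auto
  have lo: "(w', v) \<in> r" and hi: "(v, z') \<in> r" if "v \<in> {w, x, y, z}" for v
    using that S int unfolding interval_def by auto
  have xy: "(x, y) \<notin> r" "(y, x) \<notin> r" "(x, w) \<notin> r" "(y, w) \<notin> r"
    using V upper_covers_incomparable covers_rel rel_antisym by blast+
  \<comment> \<open>The top lies above both \<open>x\<close> and \<open>y\<close>, which no member
    of the vee does.\<close>
  have "z' \<notin> {w, x, y}" using hi[of x] hi[of y] xy by auto
  then have z: "z' = z" using S by blast
  have "w' \<notin> {x, y}" using lo[of w] xy by auto
  moreover have "w' \<noteq> z'" using D covers_rel rel_antisym by blast
  ultimately have w: "w' = w" using S z by blast
  have ne: "w \<noteq> x'" "w \<noteq> y'" "z \<noteq> x'" "z \<noteq> y'" using D w z covers_rel by blast+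
  have "x \<noteq> z" "y \<noteq> z" "x \<noteq> w" "y \<noteq> w" using \<open>z' \<notin> {w, x, y}\<close> z V covers_rel by blast+
  then have "(x = x' \<and> y = y') \<or> (x = y' \<and> y = x')" using S ne w z V(1) by blast
  then show ?thesis using D int w z unfolding d3_def diamond_def by auto
qed

lemma d3_union: "d3 r w x y z \<Longrightarrow> d3_interval r ({w, x, y} \<union> {z})"
  unfolding d3_interval_def by (intro exI[of _ w] exI[of _ x] exI[of _ y] exI[of _ z]) auto

lemma D3mC_iff: "D3mC r \<longleftrightarrow> (\<forall>w x y. vee r w x y \<longrightarrow> (\<exists>z. d3 r w x y z))"
proof
  assume "D3mC r"
  then show "\<forall>w x y. vee r w x y \<longrightarrow> (\<exists>z. d3 r w x y z)"
    unfolding D3mC_def d3_minus_set_def using d3_of_union by metis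
next
  assume "\<forall>w x y. vee r w x y \<longrightarrow> (\<exists>z. d3 r w x y z)"
  then show "D3mC r"
    unfolding D3mC_def d3_minus_set_def using d3_union by metis
qed

lemma d3_maximum: "d3 r w x y z \<Longrightarrow> maximum_of r {w, x, y, z} z"
  unfolding d3_def diamond_def maximum_of_def interval_def
  using rel_in rel_refl by auto

lemma D3mC_VT: "D3mC r \<Longrightarrow> VT r"
  unfolding D3mC_iff VT_def d3_def diamond_def by metis

text \<open>By (D3MD) the two intervals agree as sets. Their least elements then agree by
  antisymmetry, and removing bottom and top leaves the elbows.\<close>

lemma D3MD_same_top:
  assumes "D3MD r" "d3 r w x y z" "d3 r w' x' y' z"
  shows "w = w' \<and> {x, y} = {x', y'}"
proof -
  have eq: "{w, x, y, z} = {w', x', y', z}"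
    using assms d3_maximum unfolding D3MD_def d3_interval_def by blast
  have "(w, w') \<in> r" "(w', w) \<in> r"
    using assms(2,3) eq unfolding d3_def interval_def by blast+
  then have w: "w = w'" by (rule rel_antisym)
  have "w \<notin> {x, y}" "z \<notin> {x, y}" "w' \<notin> {x', y'}" "z \<notin> {x', y'}"
    using assms(2,3) covers_rel unfolding d3_def diamond_def by blast+
  then have "{x, y} = {w, x, y, z} - {w, z}" "{x', y'} = {w', x', y', z} - {w', z}" by auto
  then show ?thesis using eq w by metis
qed

section \<open>Consequences of the completion axioms\<close>

text \<open>
  The hypothesis is shared by (D$3^-$CF) and by (D$3^-$C) with (D3MD). Three elements that pairwise
  cover a common element yield three such elements further up.
\<close>

lemma NTC_if_elbows_determined:
  assumes Q: "\<And>w x y. vee r w x y \<Longrightarrow>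
    \<exists>z. d3 r w x y z \<and> (\<forall>w' x' y'. d3 r w' x' y' z \<longrightarrow> {x', y'} \<subseteq> {x, y})"
  shows "NTC r"
proof -
  have no_triple: "\<And>y z s t u. x \<noteq> y \<Longrightarrow> x \<noteq> z \<Longrightarrow> y \<noteq> z \<Longrightarrow> vee r s x y \<Longrightarrow> vee r t x z \<Longrightarrow>
    vee r u y z \<Longrightarrow> False" for x
  proof (induction x rule: up_induct)
    case (up x)
    obtain a where a: "d3 r s x y a" "\<And>w' x' y'. d3 r w' x' y' a \<Longrightarrow> {x', y'} \<subseteq> {x, y}"
      using Q[OF up.prems(4)] by blast
    obtain b where b: "d3 r t x z b" "\<And>w' x' y'. d3 r w' x' y' b \<Longrightarrow> {x', y'} \<subseteq> {x, z}"
      using Q[OF up.prems(5)] by blast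
    obtain c where c: "d3 r u y z c" "\<And>w' x' y'. d3 r w' x' y' c \<Longrightarrow> {x', y'} \<subseteq> {y, z}"
      using Q[OF up.prems(6)] by blast
    \<comment> \<open>Equal tops would force one pair of elbows into another, although the pairs
      differ.\<close>
    have ne: "a \<noteq> b" "a \<noteq> c" "b \<noteq> c"
      using a(2) b(1) b(2) c(1) up.prems(1,2,3) by blast+
    have cov: "covers r x a" "covers r y a" "covers r x b" "covers r z b"
      "covers r y c" "covers r z c"
      using a(1) b(1) c(1) unfolding d3_def diamond_def by auto
    show False
      \<comment> \<open>The old triple supplies the new bottoms: \<open>x\<close> lies under
        \<open>a\<close> and \<open>b\<close>, \<open>y\<close> under \<open>a\<close> and
        \<open>c\<close>, \<open>z\<close> under \<open>b\<close> and \<open>c\<close>. This is why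
        the three bottoms may differ in the induction.\<close>
      by (rule up.IH[of a b c x y z]) (use ne cov in \<open>auto simp: vee_def\<close>)
  qed
  show ?thesis unfolding NTC_def
  proof (intro notI, elim exE conjE)
    fix w x y z
    assume "x \<noteq> y" "x \<noteq> z" "y \<noteq> z" "covers r w x" "covers r w y" "covers r w z"
    then show False using no_triple[of x y z w w w] unfolding vee_def by blast
  qed
qed

lemma D3mCF_NTC:
  assumes "D3mCF r"
  shows "NTC r"
proof (rule NTC_if_elbows_determined)
  fix w x y assume vee: "vee r w x y"
  then have "d3_minus_set r {w, x, y}" unfolding d3_minus_set_def by blast
  then obtain z where z: "d3_interval r ({w, x, y} \<union> {z})" "covers_only r z {w, x, y}"
    using assms unfolding D3mCF_def by blast
  have d: "d3 r w x y z" using d3_of_union[OF vee z(1)] .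
  \<comment> \<open>(D\<open>3^-\<close>CF) still lets \<open>z\<close> cover \<open>w\<close>; the
    elbow strictly between them excludes this, so only \<open>x\<close> and \<open>y\<close> can be
    elbows below \<open>z\<close>.\<close>
  have "\<not> covers r w z"
    using d covers_rel unfolding d3_def diamond_def covers_def by blast
  then have "{x', y'} \<subseteq> {x, y}" if "d3 r w' x' y' z" for w' x' y'
    using z(2) that unfolding covers_only_def d3_def diamond_def by blast
  with d show "\<exists>z. d3 r w x y z \<and> (\<forall>w' x' y'. d3 r w' x' y' z \<longrightarrow> {x', y'} \<subseteq> {x, y})"
    by blast
qed

lemma D3mC_D3MF_D3mCF:
  assumes "D3mC r" "D3MF r"
  shows "D3mCF r"
  unfolding D3mCF_def d3_minus_set_def
proof (intro allI impI, elim exE conjE)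
  fix S w x y assume S: "S = {w, x, y}" and vee: "vee r w x y"
  obtain z where z: "d3 r w x y z" using assms(1) vee unfolding D3mC_iff by blast
  have "maximum_of r (S \<union> {z}) z"
    using d3_maximum[OF z] S unfolding maximum_of_def by auto
  moreover have "covers_only r z S"
    using assms(2) z S unfolding D3MF_def covers_only_def by blast
  ultimately show "\<exists>z. d3_interval r (S \<union> {z}) \<and> maximum_of r (S \<union> {z}) z \<and> covers_only r z S"
    using d3_union[OF z] S by blast
qed

lemma D3mC_D3MF_FT:
  assumes "D3mC r" "D3MF r"
  shows "FT r"
  unfolding FT_def
proof (intro allI impI)
  fix w x y z assume d: "diamond r w x y z"
  have NTC: "NTC r" using D3mCF_NTC[OF D3mC_D3MF_D3mCF[OF assms]] .
  have D: "x \<noteq> y" "covers r w x" "covers r w y" "covers r x z" "covers r y z"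
    using d unfolding diamond_def by auto
  \<comment> \<open>(NTC) allows no third cover of \<open>w\<close>. Since the poset is ranked,
    nothing else lies strictly between \<open>w\<close> and \<open>z\<close>, and (D3MF) becomes
    applicable to the diamond.\<close>
  have "{v. covers r w v \<and> covers r v z} = {x, y}"
    using NTC D unfolding NTC_def by blast
  then have "interval r w z = {w, x, y, z}"
    using ranked_short_interval[OF VT_ranked[OF D3mC_VT[OF assms(1)]] D(2,4)] by auto
  then have "d3 r w x y z" using d unfolding d3_def by blast
  then show "covers_only r z {x, y}" using assms(2) unfolding D3MF_def by blast
qed

lemma D3mC_D3MD_NTC:
  assumes "D3mC r" "D3MD r"
  shows "NTC r"
proof (rule NTC_if_elbows_determined)
  fix w x y assume "vee r w x y"
  then obtain z where z: "d3 r w x y z" using assms(1) unfolding D3mC_iff by blast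
  have "{x', y'} \<subseteq> {x, y}" if "d3 r w' x' y' z" for w' x' y'
    using D3MD_same_top[OF assms(2) z that] by blast
  with z show "\<exists>z. d3 r w x y z \<and> (\<forall>w' x' y'. d3 r w' x' y' z \<longrightarrow> {x', y'} \<subseteq> {x, y})"
    by blast
qed

lemma D3mC_D3MD_NCC:
  assumes "D3mC r" "D3MD r"
  shows "NCC r"
proof -
  have "\<And>w w' y. vee r w x y \<Longrightarrow> vee r w' x y \<Longrightarrow> w \<noteq> w' \<Longrightarrow> False" for x
  proof (induction x rule: up_induct)
    case (up x)
    obtain z z' where z: "d3 r w x y z" and z': "d3 r w' x y z'"
      using assms(1) up.prems unfolding D3mC_iff by blast
    \<comment> \<open>A common top would give \<open>w = w'\<close>. With distinct tops,
      \<open>x\<close> and \<open>y\<close> become overlapping bottoms of the pair \<open>z\<close>,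
      \<open>z'\<close>, one step above \<open>x\<close>.\<close>
    have "z \<noteq> z'" using D3MD_same_top[OF assms(2)] z z' up.prems(3) by blast
    then have "vee r x z z'" "vee r y z z'" "x \<noteq> y" "covers r x z"
      using z z' unfolding d3_def diamond_def vee_def by auto
    then show False using up.IH by blast
  qed
  then show ?thesis unfolding NCC_def by blast
qed

text \<open>Two completing elements would both cover \<open>x\<close> and \<open>y\<close>, making
  \<open>x\<close> and \<open>y\<close> the bottoms of overlapping vees.\<close>

lemma D3mC_NCC_UC3:
  assumes "D3mC r" "NCC r"
  shows "UC3 r"
  unfolding UC3_def
proof (intro allI impI)
  fix w x y assume vee: "vee r w x y"
  then obtain z where z: "d3 r w x y z" using assms(1) unfolding D3mC_iff by blast
  show "\<exists>!z. completing r w x y z"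
  proof (rule ex1I[of _ z])
    show "completing r w x y z" using vee z unfolding completing_def by blast
  next
    fix z' assume "completing r w x y z'"
    then have z': "d3 r w x y z'" unfolding completing_def by blast
    show "z' = z"
    proof (rule ccontr)
      assume "z' \<noteq> z"
      then have "vee r x z z'" "vee r y z z'" "x \<noteq> y"
        using z z' unfolding d3_def diamond_def vee_def by auto
      then show False using assms(2) unfolding NCC_def by blast
    qed
  qed
qed

end

theorem theorem4p4:
  fixes P :: "'a set" and r :: "'a rel"
  assumes "finite P" and "partial_order_on P r"
  shows
    "(VT r \<and> hasse_connected P r \<longrightarrow> UM P r \<and> CLMEE P r) \<and>
     (VT r \<longrightarrow> ranked r \<and> CLE P r) \<and>
     (VT r \<and> NTC r \<longrightarrow> SS r) \<and>
     (D3mCF r \<longrightarrow> NTC r) \<and>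
     (D3mC r \<and> D3MF r \<longrightarrow> VT r \<and> FT r) \<and>
     (D3mC r \<and> D3MD r \<longrightarrow> NCC r \<and> NTC r \<and> UC3 r)"
proof -
  interpret finite_poset P r using assms by unfold_locales
  have "CLMEE P r" if "VT r" "hasse_connected P r"
    unfolding CLMEE_def
    using VT_connected_UM[OF that] ranked_chain_length[OF VT_ranked[OF that(1)]] by blast
  then show ?thesis
    using VT_connected_UM VT_ranked ranked_CLE VT_NTC_SS D3mCF_NTC D3mC_VT D3mC_D3MF_FT
      D3mC_D3MD_NCC D3mC_D3MD_NTC D3mC_NCC_UC3 by blast
qed

end
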